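(* If $G$ is a topological group such that the topological group $G\times G$ is $\mathbb R$-factorizable and $H$ is a topological group homeomorphic to $G$ (as a topological space), then the topological group $H\times H$ is $\mathbb R$-factorizable.
   Context: All topological spaces and topological groups are assumed to be Tychonoff (including Hausdorff). A topological group $G$ is $\mathbb R$-factorizable if for any continuous function $f\colon G\to\mathbb R$ there exist a second-countable topological group $K$, a continuous homomorphism $h\colon G\to K$, and a continuous function $g\colon K\to\mathbb R$ such that $f=g\circ h$. *)

theory Defs
  imports "HOL-Analysis.Analysis" "HOL-Algebra.Group"
begin

definition Tychonoff_space :: "'a topology \<Rightarrow> bool" where
  "Tychonoff_space X \<longleftrightarrow> completely_regular_space X \<and> Hausdorff_space X"

locale topological_group = group G for G (structure) +
  fixes T :: "'a topology"
  assumes topspace_eq: "topspace T = carrier G"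
    and Tychonoff: "Tychonoff_space T"
    and continuous_mult: "continuous_map (prod_topology T T) T (\<lambda>(x, y). x \<otimes> y)"
    and continuous_inv: "continuous_map T T (\<lambda>x. inv x)"

text \<open>
  In the next definition, HOL does not allow quantifying over the element type of \<open>K\<close>, so the
  elements of \<open>K\<close> are taken to be reals, as bare points: neither the group operation nor the
  topology of \<open>\<real>\<close> is involved.  Nothing is lost, because a second-countable Hausdorff space has at
  most continuum many points; the lemmas \<open>second_countable_group_on_reals\<close> and
  \<open>R_factorizableI\<close> below make this precise.
\<close>

definition R_factorizable :: "('a, 'm) monoid_scheme \<Rightarrow> 'a topology \<Rightarrow> bool" where
  "R_factorizable G T \<longleftrightarrow>
     topological_group G T \<and>
     (\<forall>f. continuous_map T euclideanreal f \<longrightarrow>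
       (\<exists>(K :: real monoid) (S :: real topology) h g.
          topological_group K S \<and> second_countable S \<and>
          h \<in> hom G K \<and> continuous_map T S h \<and>
          continuous_map S euclideanreal g \<and>
          (\<forall>x \<in> carrier G. f x = g (h x))))"

lemma second_countable_Hausdorff_lepoll_real:
  fixes X :: "'k topology"
  assumes "second_countable X" and "Hausdorff_space X"
  shows "topspace X \<lesssim> (UNIV :: real set)"
proof -
  obtain B where B: "countable B" "\<And>V. V \<in> B \<Longrightarrow> openin X V"
    "\<And>U x. openin X U \<Longrightarrow> x \<in> U \<Longrightarrow> \<exists>V \<in> B. x \<in> V \<and> V \<subseteq> U"
    using assms(1) unfolding second_countable_def by metis
  define e where "e x = {n. x \<in> from_nat_into B n \<and> from_nat_into B n \<in> B}" for x
  have "inj_on e (topspace X)"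
  proof (rule inj_onI, rule ccontr)
    fix x y assume xy: "x \<in> topspace X" "y \<in> topspace X" "e x = e y" "x \<noteq> y"
    then obtain U where "openin X U" "x \<in> U" "y \<notin> U"
      using assms(2) unfolding Hausdorff_space_def by (metis disjnt_iff)
    then obtain V where V: "V \<in> B" "x \<in> V" "y \<notin> V"
      using B(3) by blast
    then obtain n where "from_nat_into B n = V"
      using B(1) from_nat_into_surj by metis
    then have "n \<in> e x" "n \<notin> e y"
      using V by (auto simp: e_def)
    with xy show False by simp
  qed
  then have "topspace X \<lesssim> (UNIV :: nat set set)"
    unfolding lepoll_def by blast
  then show ?thesis
    using nat_sets_eqpoll_reals lepoll_trans2 by blast
qed

lemma second_countable_group_on_reals:
  fixes K :: "('k, 'm) monoid_scheme"
  assumes "topological_group K S" and "second_countable S"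
  obtains K' :: "real monoid" and S' :: "real topology" and p q
  where "topological_group K' S'" and "second_countable S'"
    and "p \<in> iso K K'" and "homeomorphic_maps S S' p q"
proof -
  interpret K: topological_group K S by fact
  have H: "Hausdorff_space S" and C: "completely_regular_space S"
    using K.Tychonoff by (auto simp: Tychonoff_space_def)
  obtain p :: "'k \<Rightarrow> real" where inj: "inj_on p (carrier K)"
    using second_countable_Hausdorff_lepoll_real[OF assms(2) H] K.topspace_eq
    by (auto simp: lepoll_def)
  define q where "q = inv_into (carrier K) p"
  define A where "A = p ` carrier K"
  have qp [simp]: "q (p x) = x" if "x \<in> carrier K" for x
    using inj that by (simp add: q_def)
  have pq [simp]: "p (q y) = y" and qA [simp]: "q y \<in> carrier K" if "y \<in> A" for y
    using that by (auto simp: A_def)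
  have pA [simp]: "p x \<in> A" if "x \<in> carrier K" for x
    using that by (simp add: A_def)
  define S' where "S' = pullback_topology A q S"
  have top: "topspace S' = A"
    by (auto simp: S'_def topspace_pullback_topology K.topspace_eq)
  have cq: "continuous_map S' S q"
    using continuous_map_pullback[OF continuous_map_id[of S], of A q] by (simp add: S'_def)
  have cp: "continuous_map S S' p"
    unfolding S'_def
  proof (rule continuous_map_pullback')
    show "continuous_map S S (q \<circ> p)"
      by (rule continuous_map_eq[OF continuous_map_id]) (simp add: K.topspace_eq)
  qed (auto simp: K.topspace_eq)
  have hm: "homeomorphic_maps S S' p q"
    by (simp add: homeomorphic_maps_def cp cq top K.topspace_eq)
  define K' :: "real monoid" where
    "K' = \<lparr>carrier = A, mult = (\<lambda>x y. p (q x \<otimes>\<^bsub>K\<^esub> q y)), one = p \<one>\<^bsub>K\<^esub>\<rparr>"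
  have K'_sel [simp]: "carrier K' = A" "\<one>\<^bsub>K'\<^esub> = p \<one>\<^bsub>K\<^esub>"
    "x \<otimes>\<^bsub>K'\<^esub> y = p (q x \<otimes>\<^bsub>K\<^esub> q y)" for x y
    by (simp_all add: K'_def)
  interpret K': group K'
  proof (rule groupI)
    fix x assume "x \<in> carrier K'"
    then show "\<exists>y\<in>carrier K'. y \<otimes>\<^bsub>K'\<^esub> x = \<one>\<^bsub>K'\<^esub>"
      by (intro bexI[of _ "p (inv\<^bsub>K\<^esub> (q x))"]) auto
  qed (auto simp: K.m_assoc)
  have inv': "inv\<^bsub>K'\<^esub> x = p (inv\<^bsub>K\<^esub> (q x))" if "x \<in> A" for x
    by (rule K'.inv_equality) (use that in auto)
  have "topological_group K' S'"
  proof unfold_locales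
    show "topspace S' = carrier K'"
      by (simp add: top)
    have "S homeomorphic_space S'"
      using hm homeomorphic_space_def by blast
    then show "Tychonoff_space S'"
      using H C homeomorphic_Hausdorff_space homeomorphic_completely_regular_space
      unfolding Tychonoff_space_def by blast
    have "continuous_map (prod_topology S' S') (prod_topology S S) (\<lambda>(x, y). (q x, q y))"
      by (simp add: continuous_map_prod_top cq)
    from continuous_map_compose[OF continuous_map_compose[OF this K.continuous_mult] cp]
    show "continuous_map (prod_topology S' S') S' (\<lambda>(x, y). x \<otimes>\<^bsub>K'\<^esub> y)"
      by (simp add: o_def case_prod_unfold)
    show "continuous_map S' S' (\<lambda>x. inv\<^bsub>K'\<^esub> x)"
      by (rule continuous_map_eq[OF continuous_map_compose[OF
            continuous_map_compose[OF cq K.continuous_inv] cp]])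
        (simp add: top inv')
  qed
  moreover have "second_countable S'"
    using hm assms(2) homeomorphic_space_def homeomorphic_space_second_countability by blast
  moreover have "p \<in> iso K K'"
    using inj by (auto simp: iso_def hom_def bij_betw_def A_def)
  ultimately show thesis
    using that hm by blast
qed

text \<open>To prove \<^term>\<open>R_factorizable G T\<close>, factorizations through groups on any type \<open>'k\<close> suffice.\<close>

lemma R_factorizableI:
  assumes "topological_group G T"
    and "\<And>f. continuous_map T euclideanreal f \<Longrightarrow>
      \<exists>(K :: ('k, 'n) monoid_scheme) S h g.
         topological_group K S \<and> second_countable S \<and>
         h \<in> hom G K \<and> continuous_map T S h \<and>
         continuous_map S euclideanreal g \<and>
         (\<forall>x \<in> carrier G. f x = g (h x))"
  shows "R_factorizable G T"
  unfolding R_factorizable_def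
proof (intro conjI allI impI)
  fix f assume "continuous_map T euclideanreal f"
  from assms(2)[OF this] obtain K :: "('k, 'n) monoid_scheme" and S h g
    where K: "topological_group K S" "second_countable S"
      and h: "h \<in> hom G K" "continuous_map T S h"
      and g: "continuous_map S euclideanreal g" "\<forall>x \<in> carrier G. f x = g (h x)"
    by blast
  obtain K' :: "real monoid" and S' p q
    where K': "topological_group K' S'" "second_countable S'"
      and p: "p \<in> iso K K'" and pq: "homeomorphic_maps S S' p q"
    using second_countable_group_on_reals[OF K] by metis
  have "p \<circ> h \<in> hom G K'"
    using h(1) p by (auto simp: iso_def hom_def Pi_iff)
  moreover have "continuous_map T S' (p \<circ> h)" "continuous_map S' euclideanreal (g \<circ> q)"
    using h(2) g(1) pq by (auto simp: homeomorphic_maps_def intro: continuous_map_compose)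
  moreover have "\<forall>x \<in> carrier G. f x = (g \<circ> q) ((p \<circ> h) x)"
    using g(2) h(1) pq topological_group.topspace_eq[OF K(1)]
    by (auto simp: homeomorphic_maps_def hom_def Pi_iff)
  ultimately show "\<exists>(K :: real monoid) (S :: real topology) h g.
      topological_group K S \<and> second_countable S \<and> h \<in> hom G K \<and> continuous_map T S h \<and>
      continuous_map S euclideanreal g \<and> (\<forall>x \<in> carrier G. f x = g (h x))"
    using K' by blast
qed (fact assms(1))

end

theory Submission
  imports Defs
begin

text \<open>
  A factorization of \<open>F\<close> through a homomorphism \<open>h\<close> from \<open>G \<times> G\<close> gives
  \<open>F (x, y) = g (h (x, 1) \<otimes> h (1, y))\<close>, so every continuous \<open>F\<close> on \<open>G \<times> G\<close> depends
  continuously on \<open>(u x, u y)\<close> for some continuous \<open>u : G \<rightarrow> \<real>\<^sup>\<omega>\<close>.  This property mentions only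
  the topology of \<open>G\<close>, hence it passes to \<open>H\<close>.  Applied to \<open>u\<^sub>n (x y\<^sup>-\<^sup>1)\<close> it yields \<open>u\<^sub>n\<^sub>+\<^sub>1\<close>;
  for \<open>e = (u\<^sub>n)\<^sub>n\<close>, the point \<open>e (x y\<^sup>-\<^sup>1)\<close> depends continuously on \<open>(e x, e y)\<close>,
  which makes the image of \<open>e\<close> a second-countable topological group and \<open>e\<close> a homomorphism.
\<close>

section \<open>Products of topological groups and subspaces of metric spaces\<close>

text \<open>It serves twice: for \<open>H \<times>\<times> H\<close> itself and for the
  second-countable group \<open>L \<times>\<times> L\<close> through which functions on it are
  factored.\<close>

lemma topological_group_DirProd:
  assumes "topological_group G S" and "topological_group H T"
  shows "topological_group (G \<times>\<times> H) (prod_topology S T)"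
proof -
  interpret G: topological_group G S by fact
  interpret H: topological_group H T by fact
  have grp: "group (G \<times>\<times> H)"
    by (intro DirProd_group G.is_group H.is_group)
  have "continuous_map (prod_topology (prod_topology S T) (prod_topology S T)) S
          ((\<lambda>(x, y). x \<otimes>\<^bsub>G\<^esub> y) \<circ> (\<lambda>p. (fst (fst p), fst (snd p))))"
    by (intro continuous_map_compose[OF _ G.continuous_mult] continuous_map_pairedI
        continuous_map_compose[OF continuous_map_fst continuous_map_fst, unfolded o_def]
        continuous_map_compose[OF continuous_map_snd continuous_map_fst, unfolded o_def])
  moreover have "continuous_map (prod_topology (prod_topology S T) (prod_topology S T)) T
          ((\<lambda>(x, y). x \<otimes>\<^bsub>H\<^esub> y) \<circ> (\<lambda>p. (snd (fst p), snd (snd p))))"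
    by (intro continuous_map_compose[OF _ H.continuous_mult] continuous_map_pairedI
        continuous_map_compose[OF continuous_map_fst continuous_map_snd, unfolded o_def]
        continuous_map_compose[OF continuous_map_snd continuous_map_snd, unfolded o_def])
  ultimately have mult: "continuous_map (prod_topology (prod_topology S T) (prod_topology S T))
      (prod_topology S T) (\<lambda>(x, y). x \<otimes>\<^bsub>G \<times>\<times> H\<^esub> y)"
    by (simp add: continuous_map_pairwise o_def case_prod_unfold mult_DirProd')
  have "continuous_map (prod_topology S T) (prod_topology S T)
      (\<lambda>(x, y). (inv\<^bsub>G\<^esub> x, inv\<^bsub>H\<^esub> y))"
    by (simp add: continuous_map_prod_top G.continuous_inv H.continuous_inv)
  then have inv: "continuous_map (prod_topology S T) (prod_topology S T)
      (\<lambda>p. inv\<^bsub>G \<times>\<times> H\<^esub> p)"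
    by (rule continuous_map_eq)
      (auto simp: G.topspace_eq H.topspace_eq inv_DirProd[OF G.is_group H.is_group])
  show ?thesis
  proof (intro topological_group.intro topological_group_axioms.intro)
    show "Tychonoff_space (prod_topology S T)"
      using G.Tychonoff H.Tychonoff
      by (simp add: Tychonoff_space_def completely_regular_space_prod_topology
          Hausdorff_space_prod_topology)
  qed (use grp mult inv in \<open>simp_all add: G.topspace_eq H.topspace_eq\<close>)
qed

lemma second_countable_top_of_set:
  "second_countable (top_of_set (A :: 'a::second_countable_topology set))"
proof -
  obtain B :: "'a set set" where B: "countable B" "\<And>V. V \<in> B \<Longrightarrow> open V"
    "\<And>U. open U \<Longrightarrow> \<exists>W\<subseteq>B. U = \<Union>W"
    using univ_second_countable by metis
  have "\<exists>V\<in>B. x \<in> V \<and> V \<subseteq> U" if "open U" "x \<in> U" for U x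
    using B(3)[OF that(1)] that(2) by blast
  then have "second_countable (euclidean :: 'a topology)"
    using B(1,2) unfolding second_countable_def open_openin[symmetric] by blast
  then show ?thesis
    by (rule second_countable_subtopology)
qed

lemma Tychonoff_top_of_set:
  "Tychonoff_space (top_of_set (A :: 'a::metric_space set))"
  by (simp add: Tychonoff_space_def metrizable_imp_Hausdorff_space
      metrizable_imp_completely_regular_space metrizable_space_euclidean
      metrizable_space_subtopology)

lemma prod_top_of_set:
  "prod_topology (top_of_set A) (top_of_set B) = top_of_set (A \<times> B)"
  by (simp flip: subtopology_Times)

section \<open>Embedding second-countable Tychonoff spaces in \<open>R^omega\<close>\<close>

text \<open>The type class topology on functions is the product topology, so
  \<open>nat \<Rightarrow> real\<close> with \<open>euclidean\<close> is
  \<open>R^omega\<close>.\<close>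

lemma continuous_map_into_sequences:
  fixes u :: "'a \<Rightarrow> nat \<Rightarrow> 'b::topological_space"
  shows "continuous_map X euclidean u \<longleftrightarrow> (\<forall>n. continuous_map X euclidean (\<lambda>x. u x n))"
  by (simp add: continuous_map_componentwise_UNIV flip: euclidean_product_topology)

text \<open>Countably many real functions, one for each pair of basic open sets, separate points
  from closed sets. Using them as coordinates gives a homeomorphism \<open>e\<close> onto its image,
  with inverse \<open>e'\<close>. Hence factorizations through arbitrary second-countable groups can
  be expressed inside \<open>R^omega\<close>.\<close>

lemma Tychonoff_second_countable_embeds_in_sequences:
  assumes "Tychonoff_space S" and "second_countable S"
  obtains e :: "'k \<Rightarrow> nat \<Rightarrow> real" and e'
  where "continuous_map S euclidean e"
    and "continuous_map (top_of_set (e ` topspace S)) S e'"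
    and "\<And>x. x \<in> topspace S \<Longrightarrow> e' (e x) = x"
proof -
  obtain B where B: "countable B" "\<And>V. V \<in> B \<Longrightarrow> openin S V"
    "\<And>U x. openin S U \<Longrightarrow> x \<in> U \<Longrightarrow> \<exists>V \<in> B. x \<in> V \<and> V \<subseteq> U"
    using assms(2) unfolding second_countable_def by metis
  define b where "b = from_nat_into B"
  define good where "good f U V \<longleftrightarrow> f ` U \<subseteq> {0} \<and> f ` (topspace S - V) \<subseteq> {1}"
    for f :: "'k \<Rightarrow> real" and U V
  \<comment> \<open>The number \<open>n\<close> codes the pair of the basic sets with indices
    \<open>prod_decode n\<close>. If no continuous function is \<open>good\<close> for this pair,
    the constant 0 fills the place, so \<open>g\<close> is defined on all codes.\<close>
  have "\<exists>f. continuous_map S euclideanreal f \<and>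
          ((\<exists>f. continuous_map S euclideanreal f \<and> good f (b (fst (prod_decode n))) (b (snd (prod_decode n))))
            \<longrightarrow> good f (b (fst (prod_decode n))) (b (snd (prod_decode n))))" for n
    using continuous_map_const[of S euclideanreal 0]
    by (metis (no_types, lifting) UNIV_I topspace_euclidean)
  then obtain g where gcont: "\<And>n. continuous_map S euclideanreal (g n)"
    and ggood: "\<And>n f. continuous_map S euclideanreal f \<Longrightarrow>
       good f (b (fst (prod_decode n))) (b (snd (prod_decode n))) \<Longrightarrow>
       good (g n) (b (fst (prod_decode n))) (b (snd (prod_decode n)))"
    by metis
  have sep: "\<exists>n. g n x = 0 \<and> g n ` (topspace S - W) \<subseteq> {1}" if W: "openin S W" "x \<in> W" for W x
  proof -
    obtain V where V: "V \<in> B" "x \<in> V" "V \<subseteq> W"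
      using B(3)[OF W] by blast
    obtain f where f: "continuous_map S euclideanreal f" "f x = 0" "f ` (topspace S - V) \<subseteq> {1}"
      using assms(1) B(2)[OF V(1)] V(2)
      unfolding Tychonoff_space_def completely_regular_space_alt' by metis
    \<comment> \<open>Complete regularity makes \<open>f\<close> vanish only at the point
      \<open>x\<close>, while \<open>good\<close> asks for zeros on a whole basic set
      \<open>U\<close>. Such a \<open>U\<close> is found where \<open>f\<close> is below
      1/2.\<close>
    have "openin S {y \<in> topspace S. f y \<in> {..<1/2}}"
      by (rule openin_continuous_map_preimage[OF f(1)]) (simp flip: open_openin)
    moreover have "x \<in> {y \<in> topspace S. f y \<in> {..<1/2}}"
      using f(2) V B(2) openin_subset by fastforce
    ultimately obtain U where U: "U \<in> B" "x \<in> U" "U \<subseteq> {y \<in> topspace S. f y \<in> {..<1/2}}"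
      using B(3) by meson
    obtain i j where ij: "b i = U" "b j = V"
      using U(1) V(1) B(1) from_nat_into_surj unfolding b_def by metis
    \<comment> \<open>Rescaling flattens \<open>f\<close> to 0 wherever \<open>f\<close> is below
      1/2, hence on \<open>U\<close>, and keeps the value 1 off \<open>V\<close>. So the pair
      \<open>(U, V)\<close> admits a good function, and the chosen \<open>g\<close> at its code is
      good too.\<close>
    have "continuous_map S euclideanreal (\<lambda>y. max 0 (2 * f y - 1))"
      by (intro continuous_intros f(1))
    moreover have "good (\<lambda>y. max 0 (2 * f y - 1)) U V"
      using U(3) f(3) by (fastforce simp: good_def max_def)
    ultimately have "good (g (prod_encode (i, j))) U V"
      using ggood[of _ "prod_encode (i, j)"] ij by simp
    then show ?thesis
      using U(2) V(3) unfolding good_def by blast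
  qed
  define e where "e x n = g n x" for x n
  define e' where "e' = inv_into (topspace S) e"
  have inj: "inj_on e (topspace S)"
  proof (rule inj_onI, rule ccontr)
    fix x y assume xy: "x \<in> topspace S" "y \<in> topspace S" "e x = e y" "x \<noteq> y"
    then obtain W where "openin S W" "x \<in> W" "y \<notin> W"
      using assms(1) unfolding Tychonoff_space_def Hausdorff_space_def by (metis disjnt_iff)
    with sep obtain n where "g n x = 0" "g n y = 1"
      using xy(2) by (metis Diff_iff image_subset_iff singletonD)
    with xy(3) show False
      unfolding e_def by (metis zero_neq_one)
  qed
  have e'e: "e' (e x) = x" if "x \<in> topspace S" for x
    using inj that by (simp add: e'_def)
  have "continuous_map S euclidean e"
    by (simp add: continuous_map_into_sequences e_def gcont)
  moreover have "continuous_map (top_of_set (e ` topspace S)) S e'"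
    unfolding continuous_map_alt
  proof (intro conjI allI impI)
    show "e' \<in> topspace (top_of_set (e ` topspace S)) \<rightarrow> topspace S"
      by (auto simp: e'e)
    fix W assume W: "openin S W"
    show "openin (top_of_set (e ` topspace S)) (e' -` W \<inter> topspace (top_of_set (e ` topspace S)))"
    proof (subst openin_subopen, clarify)
      fix a assume "a \<in> topspace (top_of_set (e ` topspace S))" "e' a \<in> W"
      then obtain x where x: "x \<in> topspace S" "a = e x" "x \<in> W"
        by (auto simp: e'e)
      then obtain n where n: "g n x = 0" "g n ` (topspace S - W) \<subseteq> {1}"
        using sep W by blast
      \<comment> \<open>Off \<open>W\<close> the function \<open>g n\<close> equals 1, so a point
        \<open>e y\<close> whose coordinate \<open>n\<close> is below 1 comes from some
        \<open>y\<close> in \<open>W\<close>. One coordinate therefore gives the neighbourhood of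
        \<open>a\<close>.\<close>
      have "open {a :: nat \<Rightarrow> real. a n < 1}"
        by (intro open_Collect_less continuous_on_const continuous_on_product_coordinates)
      then have "openin (top_of_set (e ` topspace S)) (e ` topspace S \<inter> {a. a n < 1})"
        by (rule openin_open_Int)
      moreover have "a \<in> e ` topspace S \<inter> {a. a n < 1}"
        using x n by (simp add: e_def)
      moreover have "e ` topspace S \<inter> {a. a n < 1}
          \<subseteq> e' -` W \<inter> topspace (top_of_set (e ` topspace S))"
      proof clarify
        fix y assume y: "y \<in> topspace S" "e y n < 1"
        then have "y \<in> W"
          using n(2) by (force simp: e_def image_subset_iff)
        with y show "e y \<in> e' -` W \<inter> topspace (top_of_set (e ` topspace S))"
          by (simp add: e'e)
      qed
      ultimately show "\<exists>T. openin (top_of_set (e ` topspace S)) T \<and> a \<in> T \<and>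
          T \<subseteq> e' -` W \<inter> topspace (top_of_set (e ` topspace S))"
        by blast
    qed
  qed
  ultimately show thesis
    using e'e by (rule that)
qed

section \<open>Square factorizability and its topological invariance\<close>

text \<open>
  The second-countable spaces through which \<open>F\<close> factors are taken inside \<open>\<real>\<^sup>\<omega>\<close>; combining the
  maps for the two variables, a single \<open>u\<close> serves both.
\<close>

definition square_factorizable :: "'a topology \<Rightarrow> bool" where
  "square_factorizable X \<longleftrightarrow>
     (\<forall>F. continuous_map (prod_topology X X) euclideanreal F \<longrightarrow>
       (\<exists>(u :: 'a \<Rightarrow> nat \<Rightarrow> real) k.
          continuous_map X euclidean u \<and>
          continuous_on (u ` topspace X \<times> u ` topspace X) k \<and>
          (\<forall>x \<in> topspace X. \<forall>y \<in> topspace X. F (x, y) = k (u x, u y))))"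

text \<open>This is the diagonal map of countably many maps, with the countable power of
  \<open>R^omega\<close> identified with \<open>R^omega\<close> by the pairing of natural numbers.
  It lets countably many factorizations share one map; \<open>component\<close> is the projection to
  a factor.\<close>

definition interleave :: "(nat \<Rightarrow> 'a \<Rightarrow> nat \<Rightarrow> 'b) \<Rightarrow> 'a \<Rightarrow> nat \<Rightarrow> 'b" where
  "interleave u x m = u (fst (prod_decode m)) x (snd (prod_decode m))"

definition component :: "nat \<Rightarrow> (nat \<Rightarrow> 'b) \<Rightarrow> nat \<Rightarrow> 'b" where
  "component i a j = a (prod_encode (i, j))"

lemma component_interleave [simp]: "component i (interleave u x) = u i x"
  by (simp add: component_def interleave_def fun_eq_iff)

lemma continuous_map_interleave:
  fixes u :: "nat \<Rightarrow> 'a \<Rightarrow> nat \<Rightarrow> 'b::topological_space"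
  shows "(\<And>i. continuous_map X euclidean (u i)) \<Longrightarrow> continuous_map X euclidean (interleave u)"
  by (simp add: continuous_map_into_sequences interleave_def)

lemma continuous_on_component:
  fixes f :: "'c::topological_space \<Rightarrow> nat \<Rightarrow> 'b::topological_space"
  shows "continuous_on A f \<Longrightarrow> continuous_on A (\<lambda>x. component i (f x))"
  unfolding component_def
  by (rule continuous_on_coordinatewise_then_product) (rule continuous_on_product_then_coordinatewise)

lemmas continuous_on_component_fst = continuous_on_component[OF continuous_on_fst[OF continuous_on_id]]
lemmas continuous_on_component_snd = continuous_on_component[OF continuous_on_snd[OF continuous_on_id]]

text \<open>A function on the square of \<open>Y\<close> is carried to the square of
  \<open>X\<close> by \<open>q\<close> in both variables, factored there, and brought back by
  \<open>p\<close>. No group occurs here, so the homeomorphism need not respect any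
  operation.\<close>

lemma square_factorizable_homeomorphic:
  assumes "Y homeomorphic_space X" and "square_factorizable X"
  shows "square_factorizable Y"
  unfolding square_factorizable_def
proof (intro allI impI)
  fix F assume F: "continuous_map (prod_topology Y Y) euclideanreal F"
  obtain p q where "homeomorphic_maps Y X p q"
    using assms(1) homeomorphic_space_def by blast
  then have p: "continuous_map Y X p" and q: "continuous_map X Y q"
    and qp: "\<And>y. y \<in> topspace Y \<Longrightarrow> q (p y) = y"
    by (auto simp: homeomorphic_maps_def)
  have "continuous_map (prod_topology X X) (prod_topology Y Y) (\<lambda>(x, y). (q x, q y))"
    by (simp add: continuous_map_prod_top q)
  from continuous_map_compose[OF this F] assms(2)
  obtain u :: "_ \<Rightarrow> nat \<Rightarrow> real" and k where u: "continuous_map X euclidean u"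
    and k: "continuous_on (u ` topspace X \<times> u ` topspace X) k"
    and eq: "\<And>x y. x \<in> topspace X \<Longrightarrow> y \<in> topspace X \<Longrightarrow> F (q x, q y) = k (u x, u y)"
    unfolding square_factorizable_def by (smt (verit) case_prod_conv comp_apply)
  have pX: "p y \<in> topspace X" if "y \<in> topspace Y" for y
    using p that by (auto simp: continuous_map_def)
  show "\<exists>(u :: 'a \<Rightarrow> nat \<Rightarrow> real) k. continuous_map Y euclidean u \<and>
          continuous_on (u ` topspace Y \<times> u ` topspace Y) k \<and>
          (\<forall>x \<in> topspace Y. \<forall>y \<in> topspace Y. F (x, y) = k (u x, u y))"
  proof (intro exI conjI ballI)
    show "continuous_map Y euclidean (u \<circ> p)"
      using p u by (rule continuous_map_compose)
    show "continuous_on ((u \<circ> p) ` topspace Y \<times> (u \<circ> p) ` topspace Y) k"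
      by (rule continuous_on_subset[OF k]) (auto simp: pX)
    show "F (x, y) = k ((u \<circ> p) x, (u \<circ> p) y)" if "x \<in> topspace Y" "y \<in> topspace Y" for x y
      using eq[OF pX pX] that by (simp add: qp)
  qed
qed

section \<open>From a factorization of the group square to square factorizability\<close>

lemma R_factorizable_square_imp_square_factorizable:
  assumes "topological_group G T" and "R_factorizable (G \<times>\<times> G) (prod_topology T T)"
  shows "square_factorizable T"
  unfolding square_factorizable_def
proof (intro allI impI)
  interpret G: topological_group G T by fact
  fix F assume "continuous_map (prod_topology T T) euclideanreal F"
  then obtain K :: "real monoid" and S h g where K: "topological_group K S" "second_countable S"
    and h: "h \<in> hom (G \<times>\<times> G) K" "continuous_map (prod_topology T T) S h"
    and g: "continuous_map S euclideanreal g" "\<And>x. x \<in> carrier (G \<times>\<times> G) \<Longrightarrow> F x = g (h x)"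
    using assms(2) unfolding R_factorizable_def by metis
  interpret K: topological_group K S by fact
  obtain e :: "real \<Rightarrow> nat \<Rightarrow> real" and e' where e: "continuous_map S euclidean e"
    and e': "continuous_map (top_of_set (e ` topspace S)) S e'"
    and e'e: "\<And>x. x \<in> topspace S \<Longrightarrow> e' (e x) = x"
    using Tychonoff_second_countable_embeds_in_sequences[OF K.Tychonoff K(2)] by metis
  \<comment> \<open>These are the restrictions of \<open>h\<close> to the two axes. The index is a
    natural number to fit \<open>interleave\<close>; every nonzero index repeats the second
    axis.\<close>
  define p where "p i x = h (if i = 0 then (x, \<one>\<^bsub>G\<^esub>) else (\<one>\<^bsub>G\<^esub>, x))" for i :: nat and x
  have p: "continuous_map T S (p i)" for i
  proof -
    have "continuous_map T (prod_topology T T) (\<lambda>x. if i = 0 then (x, \<one>\<^bsub>G\<^esub>) else (\<one>\<^bsub>G\<^esub>, x))"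
      by (cases "i = 0") (auto simp: continuous_map_pairwise o_def G.topspace_eq)
    from continuous_map_compose[OF this h(2)] show ?thesis
      by (simp add: p_def[abs_def] o_def)
  qed
  have pS: "p i x \<in> topspace S" if "x \<in> topspace T" for i x
    using p that by (auto simp: continuous_map_def)
  define u where "u = interleave (\<lambda>i. e \<circ> p i)"
  define k where "k = (\<lambda>(a, b). g (e' (component 0 a) \<otimes>\<^bsub>K\<^esub> e' (component 1 b)))"
  let ?A = "u ` topspace T"
  \<comment> \<open>The map \<open>e'\<close> is known to be continuous only on the image of
    \<open>e\<close>, so the two components must be seen to land there. On \<open>?A\<close> they
    do, because the blocks of \<open>u x\<close> are values of \<open>e\<close>.\<close>
  have "continuous_map (top_of_set (?A \<times> ?A)) (top_of_set (e ` topspace S)) (\<lambda>p. component 0 (fst p))"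
    "continuous_map (top_of_set (?A \<times> ?A)) (top_of_set (e ` topspace S)) (\<lambda>p. component 1 (snd p))"
    by (auto simp: u_def pS continuous_on_component_fst continuous_on_component_snd)
  from this[THEN continuous_map_compose, OF e']
  have "continuous_map (top_of_set (?A \<times> ?A)) (prod_topology S S)
      (\<lambda>p. (e' (component 0 (fst p)), e' (component 1 (snd p))))"
    by (simp only: continuous_map_pairwise o_def fst_conv snd_conv)
  from continuous_map_compose[OF continuous_map_compose[OF this K.continuous_mult] g(1)]
  have "continuous_on (?A \<times> ?A) k"
    by (simp add: k_def o_def case_prod_unfold)
  moreover have "continuous_map T euclidean u"
    unfolding u_def by (intro continuous_map_interleave continuous_map_compose[OF p e])
  moreover have "F (x, y) = k (u x, u y)" if "x \<in> topspace T" "y \<in> topspace T" for x y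
  proof -
    have xy: "x \<in> carrier G" "y \<in> carrier G"
      using that by (auto simp: G.topspace_eq)
    have "h (x, y) = h ((x, \<one>\<^bsub>G\<^esub>) \<otimes>\<^bsub>G \<times>\<times> G\<^esub> (\<one>\<^bsub>G\<^esub>, y))"
      using xy by simp
    also have "\<dots> = p 0 x \<otimes>\<^bsub>K\<^esub> p 1 y"
      using xy by (subst hom_mult[OF h(1)]) (auto simp: p_def)
    finally show ?thesis
      using that xy by (simp add: g(2) k_def u_def e'e pS)
  qed
  ultimately show "\<exists>(u :: 'a \<Rightarrow> nat \<Rightarrow> real) k. continuous_map T euclidean u \<and>
          continuous_on (u ` topspace T \<times> u ` topspace T) k \<and>
          (\<forall>x \<in> topspace T. \<forall>y \<in> topspace T. F (x, y) = k (u x, u y))"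
    by blast
qed

section \<open>A second-countable image group from square factorizability\<close>

text \<open>Each coordinate of \<open>F\<close> has its own factorization; interleaving the maps
  \<open>u i\<close> yields one map that determines all coordinates at once.\<close>

lemma square_factorizable_sequences:
  fixes F :: "'a \<times> 'a \<Rightarrow> nat \<Rightarrow> real"
  assumes "square_factorizable X" and "continuous_map (prod_topology X X) euclidean F"
  shows "\<exists>(u :: 'a \<Rightarrow> nat \<Rightarrow> real) (k :: (nat \<Rightarrow> real) \<times> (nat \<Rightarrow> real) \<Rightarrow> nat \<Rightarrow> real).
          continuous_map X euclidean u \<and>
          continuous_on (u ` topspace X \<times> u ` topspace X) k \<and>
          (\<forall>x \<in> topspace X. \<forall>y \<in> topspace X. F (x, y) = k (u x, u y))"
proof -
  have "continuous_map (prod_topology X X) euclideanreal (\<lambda>p. F p i)" for i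
    using assms(2) by (simp add: continuous_map_into_sequences)
  then have "\<exists>(u :: 'a \<Rightarrow> nat \<Rightarrow> real) k. continuous_map X euclidean u \<and>
          continuous_on (u ` topspace X \<times> u ` topspace X) k \<and>
          (\<forall>x \<in> topspace X. \<forall>y \<in> topspace X. F (x, y) i = k (u x, u y))" for i
    using assms(1) unfolding square_factorizable_def by fast
  then obtain u :: "nat \<Rightarrow> 'a \<Rightarrow> nat \<Rightarrow> real" and k where u: "\<And>i. continuous_map X euclidean (u i)"
    and k: "\<And>i. continuous_on (u i ` topspace X \<times> u i ` topspace X) (k i)"
    and eq: "\<And>i x y. x \<in> topspace X \<Longrightarrow> y \<in> topspace X \<Longrightarrow> F (x, y) i = k i (u i x, u i y)"
    by metis
  let ?A = "interleave u ` topspace X"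
  show ?thesis
  proof (intro exI conjI ballI)
    show "continuous_map X euclidean (interleave u)"
      by (rule continuous_map_interleave) (rule u)
    show "continuous_on (?A \<times> ?A) (\<lambda>p i. k i (component i (fst p), component i (snd p)))"
    proof (intro continuous_on_coordinatewise_then_product)
      fix i
      show "continuous_on (?A \<times> ?A) (\<lambda>p. k i (component i (fst p), component i (snd p)))"
        by (rule continuous_on_compose2[OF k]) (auto intro!: continuous_on_Pair continuous_on_component_fst continuous_on_component_snd)
    qed
  qed (simp add: eq fun_eq_iff)
qed

text \<open>A single use of square factorizability bounds \<open>v\<close> at quotients by another
  map \<open>w\<close>, which may be finer than \<open>v\<close>. Joining all stages of the
  iteration removes this defect: each block of \<open>e\<close> at a quotient is determined by the
  next block, which is again part of \<open>e\<close>.\<close>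

lemma division_factorization:
  fixes u :: "'a \<Rightarrow> nat \<Rightarrow> real"
  assumes "topological_group H T" and "square_factorizable T" and "continuous_map T euclidean u"
  obtains e :: "'a \<Rightarrow> nat \<Rightarrow> real" and C
  where "continuous_map T euclidean e" and "\<And>x. u x = component 0 (e x)"
    and "continuous_on (e ` carrier H \<times> e ` carrier H) C"
    and "\<And>x y. x \<in> carrier H \<Longrightarrow> y \<in> carrier H \<Longrightarrow> e (x \<otimes>\<^bsub>H\<^esub> inv\<^bsub>H\<^esub> y) = C (e x, e y)"
proof -
  interpret H: topological_group H T by fact
  have div: "continuous_map (prod_topology T T) T (\<lambda>p. fst p \<otimes>\<^bsub>H\<^esub> inv\<^bsub>H\<^esub> (snd p))"
  proof -
    have "continuous_map (prod_topology T T) (prod_topology T T) (\<lambda>(x, y). (x, inv\<^bsub>H\<^esub> y))"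
      by (simp add: continuous_map_prod_top H.continuous_inv)
    from continuous_map_compose[OF this H.continuous_mult] show ?thesis
      by (simp add: o_def case_prod_unfold)
  qed
  define step where "step v w \<longleftrightarrow> (\<exists>c. continuous_on (w ` carrier H \<times> w ` carrier H) c \<and>
      (\<forall>x \<in> carrier H. \<forall>y \<in> carrier H. v (x \<otimes>\<^bsub>H\<^esub> inv\<^bsub>H\<^esub> y) = c (w x, w y)))"
    for v w :: "'a \<Rightarrow> nat \<Rightarrow> real"
  have ex_step: "\<exists>w. continuous_map T euclidean w \<and> step v w"
    if v: "continuous_map T euclidean v" for v
  proof -
    obtain w :: "'a \<Rightarrow> nat \<Rightarrow> real" and c where w: "continuous_map T euclidean w"
      "continuous_on (w ` topspace T \<times> w ` topspace T) c"
      "\<forall>x \<in> topspace T. \<forall>y \<in> topspace T.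
        (v \<circ> (\<lambda>p. fst p \<otimes>\<^bsub>H\<^esub> inv\<^bsub>H\<^esub> (snd p))) (x, y) = c (w x, w y)"
      using square_factorizable_sequences[OF assms(2) continuous_map_compose[OF div v]] by blast
    then have "step v w"
      unfolding step_def H.topspace_eq by (intro exI[of _ c]) simp
    then show ?thesis
      using w(1) by blast
  qed
  \<comment> \<open>Dependent choice; the clause for \<open>n = 0\<close> forces the sequence to
    start at the given \<open>u\<close>.\<close>
  have "\<exists>v. \<forall>n. (continuous_map T euclidean (v n) \<and> (n = 0 \<longrightarrow> v n = u)) \<and> step (v n) (v (Suc n))"
  proof (rule dependent_nat_choice)
    show "\<exists>v. continuous_map T euclidean v \<and> ((0::nat) = 0 \<longrightarrow> v = u)"
      using assms(3) by blast
    show "\<exists>w. (continuous_map T euclidean w \<and> (Suc n = 0 \<longrightarrow> w = u)) \<and> step v w"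
      if "continuous_map T euclidean v \<and> (n = 0 \<longrightarrow> v = u)" for v n
      using ex_step that by simp
  qed
  then obtain v where v0: "v 0 = u" and v: "\<And>n. continuous_map T euclidean (v n)"
    and step_v: "\<And>n. step (v n) (v (Suc n))"
    by blast
  have "\<exists>c. \<forall>n. continuous_on (v (Suc n) ` carrier H \<times> v (Suc n) ` carrier H) (c n) \<and>
      (\<forall>x \<in> carrier H. \<forall>y \<in> carrier H.
        v n (x \<otimes>\<^bsub>H\<^esub> inv\<^bsub>H\<^esub> y) = c n (v (Suc n) x, v (Suc n) y))"
    using step_v unfolding step_def by (intro choice) blast
  then obtain c where c: "\<And>n. continuous_on (v (Suc n) ` carrier H \<times> v (Suc n) ` carrier H) (c n)"
    and veq: "\<And>n x y. x \<in> carrier H \<Longrightarrow> y \<in> carrier H \<Longrightarrow>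
       v n (x \<otimes>\<^bsub>H\<^esub> inv\<^bsub>H\<^esub> y) = c n (v (Suc n) x, v (Suc n) y)"
    by blast
  \<comment> \<open>Coordinate \<open>m\<close> codes a block and a place in it. Block
    \<open>n\<close> of the result is computed from blocks \<open>Suc n\<close> of the arguments,
    hence the shift.\<close>
  define C where "C p m = c (fst (prod_decode m))
      (component (Suc (fst (prod_decode m))) (fst p), component (Suc (fst (prod_decode m))) (snd p))
      (snd (prod_decode m))" for p m
  let ?A = "interleave v ` carrier H"
  show thesis
  proof
    show "continuous_map T euclidean (interleave v)"
      by (rule continuous_map_interleave) (rule v)
    show "continuous_on (?A \<times> ?A) C"
    proof (intro continuous_on_coordinatewise_then_product)
      fix m
      show "continuous_on (?A \<times> ?A) (\<lambda>p. C p m)"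
        unfolding C_def
        by (rule continuous_on_product_then_coordinatewise, rule continuous_on_compose2[OF c])
          (auto intro!: continuous_on_Pair continuous_on_component_fst continuous_on_component_snd)
    qed
    show "u x = component 0 (interleave v x)" for x
      by (simp add: v0)
    show "interleave v (x \<otimes>\<^bsub>H\<^esub> inv\<^bsub>H\<^esub> y) = C (interleave v x, interleave v y)"
      if "x \<in> carrier H" "y \<in> carrier H" for x y
      using that by (simp add: fun_eq_iff C_def veq) (simp add: interleave_def veq)
  qed
qed

text \<open>By \<open>eC\<close>, the value of \<open>e\<close> at a quotient depends only on the
  values of \<open>e\<close> at its two arguments, so division descends to the image. Product and
  inverse are both expressible by division, and their continuity follows from that of the single
  function \<open>C\<close>.\<close>

lemma topological_group_image:
  fixes e :: "'a \<Rightarrow> 'b::metric_space"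
  assumes "group H"
    and C: "continuous_on (e ` carrier H \<times> e ` carrier H) C"
    and eC: "\<And>x y. x \<in> carrier H \<Longrightarrow> y \<in> carrier H \<Longrightarrow> e (x \<otimes>\<^bsub>H\<^esub> inv\<^bsub>H\<^esub> y) = C (e x, e y)"
  obtains L :: "'b monoid"
  where "topological_group L (top_of_set (e ` carrier H))" and "e \<in> hom H L"
proof -
  interpret H: group H by fact
  let ?A = "e ` carrier H"
  \<comment> \<open>Division by \<open>b\<close> of the identity inverts \<open>b\<close>, and
    dividing \<open>a\<close> by that inverse multiplies. Writing the product through
    \<open>C\<close> avoids choosing preimages under \<open>e\<close>.\<close>
  define L :: "'b monoid" where
    "L = \<lparr>carrier = ?A, mult = (\<lambda>a b. C (a, C (e \<one>\<^bsub>H\<^esub>, b))), one = e \<one>\<^bsub>H\<^esub>\<rparr>"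
  have e_inv: "C (e \<one>\<^bsub>H\<^esub>, e y) = e (inv\<^bsub>H\<^esub> y)" if "y \<in> carrier H" for y
    using eC[of "\<one>\<^bsub>H\<^esub>" y] that by simp
  have e_mult: "e x \<otimes>\<^bsub>L\<^esub> e y = e (x \<otimes>\<^bsub>H\<^esub> y)" if "x \<in> carrier H" "y \<in> carrier H" for x y
    using eC[of x "inv\<^bsub>H\<^esub> y"] that by (simp add: L_def e_inv)
  have L_carrier [simp]: "carrier L = ?A" and L_one [simp]: "\<one>\<^bsub>L\<^esub> = e \<one>\<^bsub>H\<^esub>"
    by (simp_all add: L_def)
  have L_group: "group L"
  proof (rule groupI)
    fix a assume "a \<in> carrier L"
    then obtain x where "x \<in> carrier H" "a = e x"
      by auto
    then show "\<exists>b\<in>carrier L. b \<otimes>\<^bsub>L\<^esub> a = \<one>\<^bsub>L\<^esub>"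
      by (intro bexI[of _ "e (inv\<^bsub>H\<^esub> x)"]) (simp_all add: e_mult)
  qed (auto simp: e_mult H.m_assoc)
  have L_inv: "inv\<^bsub>L\<^esub> a = C (e \<one>\<^bsub>H\<^esub>, a)" if "a \<in> ?A" for a
    using that by (intro group.inv_equality[OF L_group]) (auto simp: e_inv e_mult)
  have C_inv: "continuous_on ?A (\<lambda>b. C (e \<one>\<^bsub>H\<^esub>, b))"
    by (rule continuous_on_compose2[OF C]) (auto intro!: continuous_intros)
  have C_inv_in: "C (e \<one>\<^bsub>H\<^esub>, b) \<in> ?A" if "b \<in> ?A" for b
    using that by (auto simp: e_inv)
  have "topological_group L (top_of_set ?A)"
  proof (intro topological_group.intro topological_group_axioms.intro)
    have "continuous_on (?A \<times> ?A) (\<lambda>p. C (fst p, C (e \<one>\<^bsub>H\<^esub>, snd p)))"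
      by (rule continuous_on_compose2[OF C])
        (auto intro!: continuous_intros continuous_on_compose2[OF C_inv] C_inv_in)
    moreover have "(\<lambda>(a, b). a \<otimes>\<^bsub>L\<^esub> b) \<in> ?A \<times> ?A \<rightarrow> ?A"
      by (auto simp: e_mult)
    ultimately show "continuous_map (prod_topology (top_of_set ?A) (top_of_set ?A))
        (top_of_set ?A) (\<lambda>(a, b). a \<otimes>\<^bsub>L\<^esub> b)"
      by (simp add: prod_top_of_set L_def case_prod_unfold)
    have "continuous_map (top_of_set ?A) (top_of_set ?A) (\<lambda>a. C (e \<one>\<^bsub>H\<^esub>, a))"
      using C_inv C_inv_in by auto
    then show "continuous_map (top_of_set ?A) (top_of_set ?A) (\<lambda>a. inv\<^bsub>L\<^esub> a)"
      by (rule continuous_map_eq) (simp add: L_inv)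
  qed (simp_all add: L_group Tychonoff_top_of_set)
  moreover have "e \<in> hom H L"
    by (auto simp: hom_def e_mult)
  ultimately show thesis
    using that by blast
qed

text \<open>The map \<open>u\<close> that factors \<open>F\<close> need not be a homomorphism. It is
  enlarged to \<open>e\<close>, which is one onto the group \<open>L\<close> on its image, and
  \<open>F\<close> then factors through \<open>L \<times>\<times> L\<close>.\<close>

lemma square_factorizable_imp_R_factorizable_square:
  assumes "topological_group H T" and "square_factorizable T"
  shows "R_factorizable (H \<times>\<times> H) (prod_topology T T)"
proof (rule R_factorizableI)
  interpret H: topological_group H T by fact
  show "topological_group (H \<times>\<times> H) (prod_topology T T)"
    using assms(1) assms(1) by (rule topological_group_DirProd)
  fix F assume "continuous_map (prod_topology T T) euclideanreal F"
  then obtain u :: "_ \<Rightarrow> nat \<Rightarrow> real" and k where u: "continuous_map T euclidean u"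
    and k: "continuous_on (u ` carrier H \<times> u ` carrier H) k"
    and F: "\<And>x y. x \<in> carrier H \<Longrightarrow> y \<in> carrier H \<Longrightarrow> F (x, y) = k (u x, u y)"
    using assms(2) unfolding square_factorizable_def H.topspace_eq by metis
  obtain e :: "_ \<Rightarrow> nat \<Rightarrow> real" and C where e: "continuous_map T euclidean e"
    and ue: "\<And>x. u x = component 0 (e x)"
    and C: "continuous_on (e ` carrier H \<times> e ` carrier H) C"
      "\<And>x y. x \<in> carrier H \<Longrightarrow> y \<in> carrier H \<Longrightarrow> e (x \<otimes>\<^bsub>H\<^esub> inv\<^bsub>H\<^esub> y) = C (e x, e y)"
    using division_factorization[OF assms u] by metis
  let ?A = "e ` carrier H"
  obtain L :: "(nat \<Rightarrow> real) monoid"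
    where L: "topological_group L (top_of_set ?A)" and hom: "e \<in> hom H L"
    by (rule topological_group_image[OF H.is_group C])
  define h where "h = (\<lambda>(x, y). (e x, e y))"
  \<comment> \<open>Block 0 of \<open>e\<close> is \<open>u\<close>, so \<open>k\<close> recovers
    \<open>F\<close> from the two blocks.\<close>
  define g where "g = (\<lambda>p. k (component 0 (fst p), component 0 (snd p)))"
  let ?S = "prod_topology (top_of_set ?A) (top_of_set ?A)"
  have "topological_group (L \<times>\<times> L) ?S"
    using L L by (rule topological_group_DirProd)
  moreover have "second_countable ?S"
    by (simp add: prod_top_of_set second_countable_top_of_set)
  moreover have "h \<in> hom (H \<times>\<times> H) (L \<times>\<times> L)"
    using hom by (auto simp: hom_def h_def Pi_iff)
  moreover have "continuous_map (prod_topology T T) ?S h"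
  proof -
    have "continuous_map T (top_of_set ?A) e"
      using e by (simp add: continuous_map_in_subtopology H.topspace_eq)
    then show ?thesis
      unfolding h_def by (subst continuous_map_prod_top) simp
  qed
  moreover have "continuous_map ?S euclideanreal g"
  proof -
    have "continuous_on (?A \<times> ?A) g"
      unfolding g_def by (rule continuous_on_compose2[OF k]) (auto simp: ue intro!: continuous_on_Pair continuous_on_component_fst continuous_on_component_snd)
    then show ?thesis
      by (simp add: prod_top_of_set)
  qed
  moreover have "\<forall>x \<in> carrier (H \<times>\<times> H). F x = g (h x)"
    by (auto simp: F g_def h_def ue)
  ultimately show "\<exists>(K :: ((nat \<Rightarrow> real) \<times> (nat \<Rightarrow> real)) monoid) S h g.
         topological_group K S \<and> second_countable S \<and>
         h \<in> hom (H \<times>\<times> H) K \<and> continuous_map (prod_topology T T) S h \<and>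
         continuous_map S euclideanreal g \<and>
         (\<forall>x \<in> carrier (H \<times>\<times> H). F x = g (h x))"
    by blast
qed

theorem corollary3p6:
  fixes G :: "('a, 'm) monoid_scheme" and TG :: "'a topology"
    and H :: "('b, 'n) monoid_scheme" and TH :: "'b topology"
  assumes "topological_group G TG"
    and "R_factorizable (G \<times>\<times> G) (prod_topology TG TG)"
    and "topological_group H TH"
    and "TH homeomorphic_space TG"
  shows "R_factorizable (H \<times>\<times> H) (prod_topology TH TH)"
  using assms R_factorizable_square_imp_square_factorizable square_factorizable_homeomorphic
    square_factorizable_imp_R_factorizable_square by blast

end
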